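(* Let $\mathbb F$ be a field, $d\ge1$ an integer, $A=A(d,\mathbb F)$. The sequence $$\mathbb F\xrightarrow{\ \iota\ }A_1\xrightarrow{\ \partial\ }A_2\xrightarrow{\ \partial\ }A_3\xrightarrow{\ \partial\ }\cdots$$ is exact; that is, at each term $A_n$ $(n\ge1)$ the image of the incoming map equals the kernel of the outgoing map.
   Context: Algebras are associative and have a $1$. For a field $\mathbb F$ and an integer $d\ge 1$, $A=A(d,\mathbb F)$ is the $\mathbb F$-algebra defined by generators $\{e_i\}_{i=0}^d$, $\{e^*_i\}_{i=0}^d$ and relations $e_ie_j=\delta_{i,j}e_i$, $e^*_ie^*_j=\delta_{i,j}e^*_i$ $(0\le i,j\le d)$, $1=\sum_{i=0}^d e_i$, $1=\sum_{i=0}^d e^*_i$. The $e_i,e_i^*$ are the idempotent generators; the $e^*_i$ are called starred and the $e_i$ nonstarred; $i$ is the index of $e_i$ and of $e^*_i$. There is a unique $\mathbb F$-algebra automorphism $*$ of $A$, written $x\mapsto x^*$, that swaps $e_i$ and $e^*_i$ for $0\le i\le d$. For $n\ge1$, a word of length $n$ in $A$ is a product $g_1g_2\cdots g_n$ of idempotent generators such that for $2\le j\le n$ exactly one of $g_{j-1},g_j$ is starred. It ends with $g_n$. The word is nonrepeating (NR) if $g_{j-1},g_j$ have different indices for $2\le j\le n$. For $n\ge1$, $A_n$ is the subspace of $A$ spanned by the NR words that have length $n$ and end with a nonstarred element. The sum $A=\sum_{n\ge1}A_n$ is direct, and $\partial:A\to A$ is the unique $\mathbb F$-linear map such that $\partial(x)=x+(-1)^nx^*$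 for all $n\ge1$ and $x\in A_n$; it satisfies $\partial(A_n)\subseteq A_{n+1}$. The map $\iota$ is the $\mathbb F$-algebra homomorphism $\mathbb F\to A$, $a\mapsto a1$ (its image lies in $A_1$ since $1=\sum_i e_i$). *)

theory Defs
  imports Complex_Main "HOL-Library.Poly_Mapping"
begin

(* The index set {0,...,d} is represented by a finite type 'i with d + 1 elements. *)

datatype 'i generator = E 'i | Estar 'i

fun starred :: "'i generator \<Rightarrow> bool" where
  "starred (E i) = False"
| "starred (Estar i) = True"

fun index :: "'i generator \<Rightarrow> 'i" where
  "index (E i) = i"
| "index (Estar i) = i"


(* The free monoid on the generators. It is written additively, because the convolution
   product of Poly_Mapping is indexed by an additive (not necessarily commutative) monoid. *)

datatype 'i monom = Monom (letters: "'i generator list")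

instantiation monom :: (type) monoid_add
begin

definition zero_monom :: "'a monom" where
  "0 = Monom []"

definition plus_monom :: "'a monom \<Rightarrow> 'a monom \<Rightarrow> 'a monom" where
  "u + v = Monom (letters u @ letters v)"

instance
  by standard (simp_all add: zero_monom_def plus_monom_def)

end

(* The free associative unital algebra on the generators is 'i monom \<Rightarrow>\<^sub>0 'f. *)

definition free_gen :: "'i generator \<Rightarrow> ('i monom \<Rightarrow>\<^sub>0 'f::field)" where
  "free_gen g = Poly_Mapping.single (Monom [g]) 1"

definition relators :: "('i::finite monom \<Rightarrow>\<^sub>0 'f::field) set" where
  "relators =
     {free_gen (E i) * free_gen (E j) - (if i = j then free_gen (E i) else 0) | i j. True} \<union>
     {free_gen (Estar i) * free_gen (Estar j) - (if i = j then free_gen (Estar i) else 0) | i j. True} \<union>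
     {1 - (\<Sum>i\<in>UNIV. free_gen (E i)), 1 - (\<Sum>i\<in>UNIV. free_gen (Estar i))}"

(* The two-sided ideal generated by the relators. *)

inductive_set rel_ideal :: "('i::finite monom \<Rightarrow>\<^sub>0 'f::field) set" where
  zero: "0 \<in> rel_ideal"
| step: "r \<in> relators \<Longrightarrow> x \<in> rel_ideal \<Longrightarrow> a * r * b + x \<in> rel_ideal"

lemma rel_ideal_add: "x \<in> rel_ideal \<Longrightarrow> y \<in> rel_ideal \<Longrightarrow> x + y \<in> rel_ideal"
  by (induction rule: rel_ideal.induct) (auto simp: add.assoc intro: rel_ideal.intros)

lemma rel_ideal_mult_left: "x \<in> rel_ideal \<Longrightarrow> c * x \<in> rel_ideal"
proof (induction rule: rel_ideal.induct)
  case (step r x a b)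
  have "(c * a) * r * b + c * x \<in> rel_ideal"
    using step by (intro rel_ideal.step) auto
  then show ?case by (simp add: distrib_left mult.assoc)
qed (simp add: rel_ideal.zero)

lemma rel_ideal_mult_right: "x \<in> rel_ideal \<Longrightarrow> x * c \<in> rel_ideal"
proof (induction rule: rel_ideal.induct)
  case (step r x a b)
  have "a * r * (b * c) + x * c \<in> rel_ideal"
    using step by (intro rel_ideal.step) auto
  then show ?case by (simp add: distrib_right mult.assoc)
qed (simp add: rel_ideal.zero)

lemma rel_ideal_uminus: "x \<in> rel_ideal \<Longrightarrow> - x \<in> rel_ideal"
  using rel_ideal_mult_left[of x "- 1"] by simp

lemma rel_ideal_diff: "x \<in> rel_ideal \<Longrightarrow> y \<in> rel_ideal \<Longrightarrow> x - y \<in> rel_ideal"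
  using rel_ideal_add[of x "- y"] rel_ideal_uminus[of y] by simp


(* The ideal is proper: it is killed by the character sending e_i and e*_i to 1 if i = k
   and to 0 otherwise. *)

definition char_monom :: "'i \<Rightarrow> 'i monom \<Rightarrow> 'f::field" where
  "char_monom k m = (\<Prod>g\<leftarrow>letters m. if index g = k then 1 else 0)"

definition char_free :: "'i \<Rightarrow> ('i monom \<Rightarrow>\<^sub>0 'f::field) \<Rightarrow> 'f" where
  "char_free k p = (\<Sum>m\<in>Poly_Mapping.keys p. Poly_Mapping.lookup p m * char_monom k m)"

lemma char_free_superset:
  assumes "finite M" "Poly_Mapping.keys p \<subseteq> M"
  shows "char_free k p = (\<Sum>m\<in>M. Poly_Mapping.lookup p m * char_monom k m)"
  unfolding char_free_def using assms
  by (intro sum.mono_neutral_left) (auto simp: in_keys_iff)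

lemma char_free_add: "char_free k (p + q) = char_free k p + char_free k q"
proof -
  let ?M = "Poly_Mapping.keys p \<union> Poly_Mapping.keys q"
  show ?thesis
    using keys_add[of p q]
    by (simp add: char_free_superset[of ?M] lookup_add distrib_right sum.distrib)
qed

lemma char_free_0 [simp]: "char_free k 0 = 0"
  by (simp add: char_free_def)

lemma char_free_uminus: "char_free k (- p) = - char_free k p"
  using char_free_add[of k p "- p"] by (simp add: eq_neg_iff_add_eq_0 add.commute)

lemma char_free_diff: "char_free k (p - q) = char_free k p - char_free k q"
  using char_free_add[of k p "- q"] by (simp add: char_free_uminus)

lemma char_free_sum: "char_free k (\<Sum>x\<in>S. f x) = (\<Sum>x\<in>S. char_free k (f x))"
  by (induction S rule: infinite_finite_induct) (auto simp: char_free_add)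

lemma char_free_single [simp]: "char_free k (Poly_Mapping.single m c) = c * char_monom k m"
  by (simp add: char_free_def)

lemma poly_mapping_decomp: "p = (\<Sum>m\<in>Poly_Mapping.keys p. Poly_Mapping.single m (Poly_Mapping.lookup p m))"
  by (rule poly_mapping_eqI)
    (auto simp: lookup_sum lookup_single when_def in_keys_iff if_distrib cong: if_cong)

lemma char_free_mult:
  fixes p q :: "'a monom \<Rightarrow>\<^sub>0 'b::field"
  shows "char_free k (p * q) = char_free k p * char_free k q"
proof -
  have "p * q = (\<Sum>m\<in>Poly_Mapping.keys p. \<Sum>n\<in>Poly_Mapping.keys q.
      Poly_Mapping.single m (Poly_Mapping.lookup p m) * Poly_Mapping.single n (Poly_Mapping.lookup q n))"
    by (subst poly_mapping_decomp[of p], subst poly_mapping_decomp[of q])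
      (simp only: sum_product)
  moreover have "char_monom k (m + n) = (char_monom k m * char_monom k n :: 'b)" for m n
    by (simp add: char_monom_def plus_monom_def)
  ultimately have "char_free k (p * q) = (\<Sum>m\<in>Poly_Mapping.keys p. \<Sum>n\<in>Poly_Mapping.keys q.
      (Poly_Mapping.lookup p m * char_monom k m) * (Poly_Mapping.lookup q n * char_monom k n))"
    by (simp add: char_free_sum mult_single algebra_simps)
  then show ?thesis
    by (simp only: char_free_def sum_product)
qed

lemma char_free_1: "char_free k 1 = 1"
  by (simp add: char_monom_def zero_monom_def flip: single_one)

lemma char_free_gen: "char_free k (free_gen g) = (if index g = k then 1 else 0)"
  by (simp add: free_gen_def char_monom_def)

lemma char_free_rel_ideal: "x \<in> rel_ideal \<Longrightarrow> char_free k x = 0"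
  by (induction rule: rel_ideal.induct)
    (auto simp: char_free_add char_free_mult char_free_diff char_free_sum char_free_gen
      char_free_1 relators_def)

lemma one_notin_rel_ideal: "1 \<notin> rel_ideal"
  using char_free_rel_ideal[of 1] char_free_1 by (metis zero_neq_one)


quotient_type (overloaded) ('i, 'f) alg = "'i::finite monom \<Rightarrow>\<^sub>0 'f::field" / "\<lambda>p q. p - q \<in> rel_ideal"
proof (rule equivpI)
  show "reflp (\<lambda>p q :: 'i monom \<Rightarrow>\<^sub>0 'f. p - q \<in> rel_ideal)"
    by (simp add: reflp_def rel_ideal.zero)
  show "symp (\<lambda>p q :: 'i monom \<Rightarrow>\<^sub>0 'f. p - q \<in> rel_ideal)"
    unfolding symp_def using rel_ideal_uminus by fastforce
  show "transp (\<lambda>p q :: 'i monom \<Rightarrow>\<^sub>0 'f. p - q \<in> rel_ideal)"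
    unfolding transp_def using rel_ideal_add by fastforce
qed

instantiation alg :: (finite, field) ring_1
begin

lift_definition zero_alg :: "('a, 'b) alg" is 0 .

lift_definition one_alg :: "('a, 'b) alg" is 1 .

lift_definition plus_alg :: "('a, 'b) alg \<Rightarrow> ('a, 'b) alg \<Rightarrow> ('a, 'b) alg" is "(+)"
  by (simp add: add_diff_add rel_ideal_add)

lift_definition uminus_alg :: "('a, 'b) alg \<Rightarrow> ('a, 'b) alg" is uminus
  using rel_ideal_uminus by fastforce

lift_definition minus_alg :: "('a, 'b) alg \<Rightarrow> ('a, 'b) alg \<Rightarrow> ('a, 'b) alg" is "(-)"
proof -
  fix p p' q q' :: "'a monom \<Rightarrow>\<^sub>0 'b"
  assume "p - p' \<in> rel_ideal" "q - q' \<in> rel_ideal"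
  then have "(p - p') - (q - q') \<in> rel_ideal" by (rule rel_ideal_diff)
  then show "p - q - (p' - q') \<in> rel_ideal" by (simp add: algebra_simps)
qed

lift_definition times_alg :: "('a, 'b) alg \<Rightarrow> ('a, 'b) alg \<Rightarrow> ('a, 'b) alg" is "(*)"
proof -
  fix p p' q q' :: "'a monom \<Rightarrow>\<^sub>0 'b"
  assume "p - p' \<in> rel_ideal" "q - q' \<in> rel_ideal"
  then have "(p - p') * q + p' * (q - q') \<in> rel_ideal"
    by (intro rel_ideal_add rel_ideal_mult_left rel_ideal_mult_right)
  then show "p * q - p' * q' \<in> rel_ideal" by (simp add: algebra_simps)
qed

instance
proof
  show "(0 :: ('a, 'b) alg) \<noteq> 1"
    by transfer (use one_notin_rel_ideal rel_ideal_uminus in fastforce)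
qed (transfer, simp add: algebra_simps rel_ideal.zero)+

end

lift_definition iota :: "'f::field \<Rightarrow> ('i::finite, 'f) alg" is "Poly_Mapping.single 0" .

definition scale :: "'f::field \<Rightarrow> ('i::finite, 'f) alg \<Rightarrow> ('i, 'f) alg" where
  "scale a x = iota a * x"

lemma iota_0 [simp]: "iota 0 = 0"
  by transfer (simp add: rel_ideal.zero)

lemma iota_1 [simp]: "iota 1 = 1"
  by transfer (simp add: rel_ideal.zero)

lemma iota_add: "iota (a + b) = iota a + iota b"
  by transfer (simp add: single_add rel_ideal.zero)

lemma iota_mult: "iota (a * b) = iota a * iota b"
  by transfer (simp add: mult_single rel_ideal.zero)

lemma iota_eq_scale: "iota a = scale a 1"
  by (simp add: scale_def)

global_interpretation alg: vector_space scale
  by standard (simp_all add: scale_def iota_add iota_mult algebra_simps)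

lift_definition gen :: "'i::finite generator \<Rightarrow> ('i, 'f::field) alg" is free_gen .

definition alg_automorphism :: "(('i::finite, 'f::field) alg \<Rightarrow> ('i, 'f) alg) \<Rightarrow> bool" where
  "alg_automorphism s \<longleftrightarrow>
     Vector_Spaces.linear scale scale s \<and> s 1 = 1 \<and> (\<forall>x y. s (x * y) = s x * s y) \<and> bij s"

definition star :: "('i::finite, 'f::field) alg \<Rightarrow> ('i, 'f) alg" where
  "star = (THE s. alg_automorphism s \<and>
     (\<forall>i. s (gen (E i)) = gen (Estar i) \<and> s (gen (Estar i)) = gen (E i)))"


(* Words are represented by their lists of factors. *)

definition is_word :: "'i generator list \<Rightarrow> bool" where
  "is_word gs \<longleftrightarrow> gs \<noteq> [] \<and> successively (\<lambda>g h. starred g \<noteq> starred h) gs"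

definition nonrepeating :: "'i generator list \<Rightarrow> bool" where
  "nonrepeating gs \<longleftrightarrow> successively (\<lambda>g h. index g \<noteq> index h) gs"

definition A_sub :: "nat \<Rightarrow> ('i::finite, 'f::field) alg set" where
  "A_sub n = alg.span {prod_list (map gen gs) | gs.
     is_word gs \<and> nonrepeating gs \<and> length gs = n \<and> \<not> starred (last gs)}"

definition boundary :: "('i::finite, 'f::field) alg \<Rightarrow> ('i, 'f) alg" where
  "boundary = (THE D. Vector_Spaces.linear scale scale D \<and>
     (\<forall>n\<ge>1. \<forall>x\<in>A_sub n. D x = x + (- 1) ^ n * star x))"

end

theory Submission
  imports Defs "HOL-Library.Function_Algebras"
begin

text \<open>Identify a nonrepeating word ending with a nonstarred factor with the sequence of its indices.
  Inserting \<open>1\<close>, written as the sum of the starred or of the nonstarred idempotents, at every place of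
  a word and taking the alternating sum, only the two outer places contribute, and one obtains
  \<open>x + (- 1) ^ n * star x\<close>. So \<open>\<partial>\<close> is the coboundary of normalized simplicial cochains on the full
  simplex, which is contractible by prepending a fixed vertex. That nonrepeating words are linearly
  independent follows from a representation on cochains in which \<open>star\<close> acts by the involution
  \<open>(- 1) ^ n * (\<partial> f - f)\<close>.\<close>

section \<open>Modules and the star automorphism\<close>

lemma abs_alg_add: "abs_alg (p + q) = abs_alg p + abs_alg q"
  by (simp add: plus_alg.abs_eq)

lemma abs_alg_sum: "abs_alg (\<Sum>x\<in>S. f x) = (\<Sum>x\<in>S. abs_alg (f x))"
  by (induction S rule: infinite_finite_induct) (auto simp: abs_alg_add zero_alg_def)

lemma abs_alg_monom: "abs_alg (Poly_Mapping.single (Monom gs) 1) = prod_list (map gen gs)"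
proof (induction gs)
  case Nil
  then show ?case by (simp add: one_alg_def flip: zero_monom_def single_one)
next
  case (Cons g gs)
  have "Poly_Mapping.single (Monom (g # gs)) 1
      = free_gen g * (Poly_Mapping.single (Monom gs) 1 :: _ \<Rightarrow>\<^sub>0 'b)"
    by (simp add: free_gen_def mult_single plus_monom_def)
  then show ?case
    using Cons by (simp add: gen.abs_eq flip: times_alg.abs_eq)
qed

lemma abs_alg_single:
  "abs_alg (Poly_Mapping.single m c) = scale c (prod_list (map gen (letters m)))"
proof -
  have "Poly_Mapping.single m c = Poly_Mapping.single 0 c * Poly_Mapping.single m 1"
    by (simp add: mult_single)
  then show ?thesis
    by (simp add: scale_def iota.abs_eq flip: abs_alg_monom times_alg.abs_eq)
qed

text \<open>Every element is the class of a polynomial, hence a linear combination of products of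
  generators. Letters are attached on the right to match the right actions below.\<close>

lemma alg_induct [case_names subspace one gen]:
  assumes "alg.subspace {x. P x}" and "P 1" and "\<And>x g. P x \<Longrightarrow> P (x * gen g)"
  shows "P x"
proof -
  have "P (prod_list (map gen gs))" for gs
    by (induction gs rule: rev_induct) (use assms in auto)
  moreover obtain p where "x = abs_alg p"
    by (induction x rule: alg.abs_induct) auto
  then have "x = abs_alg (\<Sum>m\<in>Poly_Mapping.keys p. Poly_Mapping.single m (Poly_Mapping.lookup p m))"
    using poly_mapping_decomp[of p] by argo
  then have "x = (\<Sum>m\<in>Poly_Mapping.keys p. abs_alg (Poly_Mapping.single m (Poly_Mapping.lookup p m)))"
    by (simp only: abs_alg_sum)
  moreover have "(\<Sum>m\<in>Poly_Mapping.keys p. abs_alg (Poly_Mapping.single m (Poly_Mapping.lookup p m))) \<in> {x. P x}"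
    using calculation(1)
    by (intro alg.subspace_sum assms(1)) (simp add: abs_alg_single alg.subspace_scale[OF assms(1), simplified])
  ultimately show ?thesis by simp
qed

lemma gen_E_mult: "gen (E i) * gen (E j) = (if i = j then gen (E i) else 0)"
proof -
  have "free_gen (E i) * free_gen (E j) - (if i = j then free_gen (E i) else 0) \<in> (relators :: ('a monom \<Rightarrow>\<^sub>0 'b) set)"
    by (auto simp: relators_def)
  from rel_ideal.step[OF this rel_ideal.zero, of 1 1]
  have "abs_alg (free_gen (E i) * free_gen (E j)) = abs_alg (if i = j then free_gen (E i) else 0 :: 'a monom \<Rightarrow>\<^sub>0 'b)"
    by (simp only: alg.abs_eq_iff) simp
  then show ?thesis
    by (simp add: gen.abs_eq zero_alg_def times_alg.abs_eq if_distrib[of abs_alg])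
qed

lemma gen_Estar_mult: "gen (Estar i) * gen (Estar j) = (if i = j then gen (Estar i) else 0)"
proof -
  have "free_gen (Estar i) * free_gen (Estar j) - (if i = j then free_gen (Estar i) else 0) \<in> (relators :: ('a monom \<Rightarrow>\<^sub>0 'b) set)"
    by (auto simp: relators_def)
  from rel_ideal.step[OF this rel_ideal.zero, of 1 1]
  have "abs_alg (free_gen (Estar i) * free_gen (Estar j)) = abs_alg (if i = j then free_gen (Estar i) else 0 :: 'a monom \<Rightarrow>\<^sub>0 'b)"
    by (simp only: alg.abs_eq_iff) simp
  then show ?thesis
    by (simp add: gen.abs_eq zero_alg_def times_alg.abs_eq if_distrib[of abs_alg])
qed

lemma sum_gen_E: "(\<Sum>i\<in>UNIV. gen (E i)) = 1"
proof -
  have "1 - (\<Sum>i\<in>UNIV. free_gen (E i)) \<in> (relators :: ('a monom \<Rightarrow>\<^sub>0 'b) set)"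
    by (auto simp: relators_def)
  from rel_ideal.step[OF this rel_ideal.zero, of 1 1]
  have "1 = abs_alg (\<Sum>i\<in>UNIV. free_gen (E i :: 'a generator) :: _ \<Rightarrow>\<^sub>0 'b)"
    by (simp add: one_alg_def alg.abs_eq_iff)
  then show ?thesis by (simp add: abs_alg_sum gen.abs_eq)
qed

lemma sum_gen_Estar: "(\<Sum>i\<in>UNIV. gen (Estar i)) = 1"
proof -
  have "1 - (\<Sum>i\<in>UNIV. free_gen (Estar i)) \<in> (relators :: ('a monom \<Rightarrow>\<^sub>0 'b) set)"
    by (auto simp: relators_def)
  from rel_ideal.step[OF this rel_ideal.zero, of 1 1]
  have "1 = abs_alg (\<Sum>i\<in>UNIV. free_gen (Estar i :: 'a generator) :: _ \<Rightarrow>\<^sub>0 'b)"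
    by (simp add: one_alg_def alg.abs_eq_iff)
  then show ?thesis by (simp add: abs_alg_sum gen.abs_eq)
qed

text \<open>By the presentation, operators of the generators that obey the defining relations make a
  right module. This serves twice: on the algebra itself, to construct \<open>star\<close>, and on
  cochains, to detect linear independence.\<close>

locale right_module = vector_space scl
  for scl :: "'f::field \<Rightarrow> 'v::ab_group_add \<Rightarrow> 'v" +
  fixes act :: "'i::finite generator \<Rightarrow> 'v \<Rightarrow> 'v"
  assumes act_add: "act g (u + v) = act g u + act g v"
    and act_scl: "act g (scl c v) = scl c (act g v)"
    and act_E: "act (E j) (act (E i) v) = (if i = j then act (E i) v else 0)"
    and act_Estar: "act (Estar j) (act (Estar i) v) = (if i = j then act (Estar i) v else 0)"
    and sum_act_E: "(\<Sum>i\<in>UNIV. act (E i) v) = v"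
    and sum_act_Estar: "(\<Sum>i\<in>UNIV. act (Estar i) v) = v"
begin

text \<open>\<open>fold\<close> applies the leftmost letter first, as a right action
  requires.\<close>

definition free_act :: "'v \<Rightarrow> ('i monom \<Rightarrow>\<^sub>0 'f) \<Rightarrow> 'v" where
  "free_act v p = (\<Sum>m\<in>Poly_Mapping.keys p. scl (Poly_Mapping.lookup p m) (fold act (letters m) v))"

lemma fold_act_add: "fold act gs (u + v) = fold act gs u + fold act gs v"
  by (induction gs arbitrary: u v) (auto simp: act_add)

lemma fold_act_scl: "fold act gs (scl c v) = scl c (fold act gs v)"
  by (induction gs arbitrary: v) (auto simp: act_scl)

lemma fold_act_0: "fold act gs 0 = 0"
  using fold_act_add[of gs 0 0] by simp

lemma fold_act_sum: "fold act gs (\<Sum>x\<in>S. f x) = (\<Sum>x\<in>S. fold act gs (f x))"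
  by (induction S rule: infinite_finite_induct) (auto simp: fold_act_add fold_act_0)

lemma free_act_superset:
  assumes "finite M" "Poly_Mapping.keys p \<subseteq> M"
  shows "free_act v p = (\<Sum>m\<in>M. scl (Poly_Mapping.lookup p m) (fold act (letters m) v))"
  unfolding free_act_def using assms
  by (intro sum.mono_neutral_left) (auto simp: in_keys_iff)

lemma free_act_add: "free_act v (p + q) = free_act v p + free_act v q"
proof -
  let ?M = "Poly_Mapping.keys p \<union> Poly_Mapping.keys q"
  show ?thesis
    using keys_add[of p q]
    by (simp add: free_act_superset[of ?M] lookup_add scale_left_distrib sum.distrib)
qed

lemma free_act_0 [simp]: "free_act v 0 = 0"
  by (simp add: free_act_def)

lemma free_act_zero [simp]: "free_act 0 p = 0"
  by (simp add: free_act_def fold_act_0)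

lemma free_act_diff: "free_act v (p - q) = free_act v p - free_act v q"
  using free_act_add[of v "p - q" q] by simp

lemma free_act_sum: "free_act v (\<Sum>x\<in>S. f x) = (\<Sum>x\<in>S. free_act v (f x))"
  by (induction S rule: infinite_finite_induct) (auto simp: free_act_add)

lemma free_act_single [simp]:
  "free_act v (Poly_Mapping.single m c) = scl c (fold act (letters m) v)"
  by (simp add: free_act_def)

lemma free_act_mult: "free_act v (p * q) = free_act (free_act v p) q"
proof -
  have "p * q = (\<Sum>m\<in>Poly_Mapping.keys p. \<Sum>n\<in>Poly_Mapping.keys q.
      Poly_Mapping.single m (Poly_Mapping.lookup p m) * Poly_Mapping.single n (Poly_Mapping.lookup q n))"
    by (subst poly_mapping_decomp[of p], subst poly_mapping_decomp[of q])
      (simp only: sum_product)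
  then have "free_act v (p * q) = (\<Sum>m\<in>Poly_Mapping.keys p. \<Sum>n\<in>Poly_Mapping.keys q.
      scl (Poly_Mapping.lookup q n) (fold act (letters n)
        (scl (Poly_Mapping.lookup p m) (fold act (letters m) v))))"
    by (simp add: free_act_sum mult_single plus_monom_def fold_act_scl mult.commute)
  also have "\<dots> = (\<Sum>n\<in>Poly_Mapping.keys q. \<Sum>m\<in>Poly_Mapping.keys p.
      scl (Poly_Mapping.lookup q n) (fold act (letters n)
        (scl (Poly_Mapping.lookup p m) (fold act (letters m) v))))"
    by (rule sum.swap)
  also have "\<dots> = free_act (free_act v p) q"
    by (simp only: free_act_def fold_act_sum scale_sum_right)
  finally show ?thesis .
qed

lemma free_act_1: "free_act v 1 = v"
  by (simp add: zero_monom_def flip: single_one)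

lemma free_act_gen: "free_act v (free_gen g) = act g v"
  by (simp add: free_gen_def)

lemma free_act_rel_ideal: "x \<in> rel_ideal \<Longrightarrow> free_act v x = 0"
proof (induction rule: rel_ideal.induct)
  case (step r x a b)
  \<comment> \<open>All \<open>u\<close> are needed: in \<open>a * r * b\<close> the relator meets
    the vector \<open>free_act v a\<close>.\<close>
  have "free_act u r = 0" for u
    using step(1)
    by (auto simp: relators_def free_act_diff free_act_mult free_act_gen free_act_sum free_act_1
        act_E act_Estar sum_act_E sum_act_Estar)
  then show ?case using step by (simp add: free_act_add free_act_mult)
qed simp

text \<open>\<open>orbit v\<close> is the homomorphism of right modules from the algebra that takes
  \<open>1\<close> to \<open>v\<close>.\<close>

lift_definition orbit :: "'v \<Rightarrow> ('i, 'f) alg \<Rightarrow> 'v" is free_act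
  by (metis free_act_rel_ideal free_act_diff right_minus_eq)

lemma orbit_add: "orbit v (x + y) = orbit v x + orbit v y"
  by transfer (rule free_act_add)

lemma orbit_0 [simp]: "orbit v 0 = 0"
  using orbit_add[of v 0 0] by simp

lemma orbit_mult: "orbit v (x * y) = orbit (orbit v x) y"
  by transfer (rule free_act_mult)

lemma orbit_one: "orbit v 1 = v"
  by transfer (rule free_act_1)

lemma orbit_gen: "orbit v (gen g) = act g v"
  by transfer (rule free_act_gen)

lemma orbit_iota: "orbit v (iota c) = scl c v"
  by transfer (simp add: zero_monom_def)

lemma orbit_scl: "orbit (scl c v) x = scl c (orbit v x)"
  by transfer (simp add: free_act_def fold_act_scl scale_sum_right mult.commute)

lemma orbit_scale: "orbit v (scale c x) = scl c (orbit v x)"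
  by (simp add: scale_def orbit_mult orbit_iota orbit_scl)

lemma linear_orbit: "Vector_Spaces.linear scale scl (orbit v)"
  by unfold_locales (simp_all add: orbit_add orbit_scale)

end

section \<open>The automorphism exchanging starred and nonstarred idempotents\<close>

fun swap_star :: "'i generator \<Rightarrow> 'i generator" where
  "swap_star (E i) = Estar i"
| "swap_star (Estar i) = E i"

lemma swap_star_swap_star [simp]: "swap_star (swap_star g) = g"
  by (cases g) auto

lemma scale_mult_left: "scale c x * y = scale c (x * y)"
  by (simp add: scale_def mult.assoc)

text \<open>\<open>scale\<close> multiplies from the left, so bilinearity of the product needs
  scalars to be central. They commute with each generator because the empty monomial is neutral on
  both sides.\<close>

lemma iota_commute: "iota c * x = x * iota c"
proof (induction x rule: alg_induct)
  case subspace
  have "iota c * (iota a * x) = iota a * (x * iota c)" if "iota c * x = x * iota c" for a x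
    unfolding that[symmetric] by (simp add: mult.commute flip: iota_mult mult.assoc)
  then show ?case
    by (auto simp: alg.subspace_def scale_def distrib_left distrib_right mult.assoc)
next
  case (gen x g)
  have "iota c * gen g = gen g * iota c"
    by transfer (simp add: free_gen_def mult_single rel_ideal.zero)
  with gen show ?case by (metis mult.assoc)
qed simp

lemma scale_mult_right: "x * scale c y = scale c (x * y)"
  by (metis scale_def iota_commute mult.assoc)

text \<open>The defining relations are symmetric under the swap, so right multiplication by swapped
  generators is again a module structure. The orbit map of \<open>1\<close> is then the candidate
  for \<open>star\<close>.\<close>

interpretation star_action: right_module scale "\<lambda>g x. x * gen (swap_star g)"
  by unfold_locales
    (simp_all add: distrib_right scale_mult_left mult.assoc gen_E_mult gen_Estar_mult
      sum_gen_E sum_gen_Estar if_distrib flip: sum_distrib_left cong: if_cong)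

lemma alg_automorphism_eqI:
  assumes "alg_automorphism s" "alg_automorphism t" "\<And>g. s (gen g) = t (gen g)"
  shows "s = t"
proof
  fix x
  interpret s: Vector_Spaces.linear scale scale s using assms(1) by (simp add: alg_automorphism_def)
  interpret t: Vector_Spaces.linear scale scale t using assms(2) by (simp add: alg_automorphism_def)
  show "s x = t x"
    by (induction x rule: alg_induct)
      (use assms in \<open>auto simp: alg.subspace_def alg_automorphism_def s.add t.add s.scale t.scale\<close>)
qed

text \<open>The operators are right multiplications and so commute with left multiplication by
  \<open>v\<close>. This makes the orbit map of \<open>1\<close> multiplicative.\<close>

lemma star_orbit: "star_action.orbit v x = v * star_action.orbit 1 x"
proof (induction x rule: alg_induct)
  case subspace
  then show ?case
    by (simp add: alg.subspace_def star_action.orbit_add star_action.orbit_scale distrib_left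
        scale_mult_right)
qed (simp_all add: star_action.orbit_one star_action.orbit_mult star_action.orbit_gen
    flip: mult.assoc)

lemma star_orbit_mult:
  "star_action.orbit 1 (x * y) = star_action.orbit 1 x * star_action.orbit 1 y"
  by (metis star_action.orbit_mult star_orbit)

text \<open>Existence: the orbit map of \<open>1\<close> is multiplicative and squares to the
  identity, since it does so on generators; in particular it is bijective. Uniqueness: an
  automorphism is determined by its values on generators.\<close>

lemma star_eq_orbit: "star = star_action.orbit 1"
proof -
  let ?s = "star_action.orbit 1 :: ('a, 'b) alg \<Rightarrow> _"
  have inv: "?s (?s x) = x" for x
    by (induction x rule: alg_induct)
      (auto simp: alg.subspace_def star_action.orbit_add star_action.orbit_scale
        star_action.orbit_one star_orbit_mult star_action.orbit_gen)
  have "bij ?s"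
    by (rule o_bij[of ?s]) (rule ext, simp only: o_apply inv id_apply)+
  then have aut: "alg_automorphism ?s"
    unfolding alg_automorphism_def
    by (intro conjI allI star_action.linear_orbit star_action.orbit_one star_orbit_mult)
  show ?thesis
    unfolding star_def
  proof (rule the_equality)
    fix t :: "('a, 'b) alg \<Rightarrow> _"
    assume t: "alg_automorphism t \<and> (\<forall>i. t (gen (E i)) = gen (Estar i) \<and> t (gen (Estar i)) = gen (E i))"
    have "t (gen g) = ?s (gen g)" for g
      using t by (cases g) (auto simp: star_action.orbit_gen)
    then show "t = ?s" using t aut by (intro alg_automorphism_eqI) auto
  qed (use aut in \<open>simp add: star_action.orbit_gen\<close>)
qed

lemma star_mult: "star (x * y) = star x * star y"
  by (simp add: star_eq_orbit star_orbit_mult)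

lemma star_gen [simp]: "star (gen g) = gen (swap_star g)"
  by (simp add: star_eq_orbit star_action.orbit_gen)

lemma star_1 [simp]: "star 1 = 1"
  by (simp add: star_eq_orbit star_action.orbit_one)

lemma star_add: "star (x + y) = star x + star y"
  by (simp add: star_eq_orbit star_action.orbit_add)

lemma star_0 [simp]: "star 0 = 0"
  using star_add[of 0 0] by simp

lemma star_scale: "star (scale c x) = scale c (star x)"
  by (simp add: star_eq_orbit star_action.orbit_scale)

lemma star_sum: "star (\<Sum>x\<in>S. f x) = (\<Sum>x\<in>S. star (f x))"
  by (induction S rule: infinite_finite_induct) (auto simp: star_add)

lemma star_star [simp]: "star (star x) = x"
  by (induction x rule: alg_induct)
    (auto simp: alg.subspace_def star_add star_scale star_mult)


section \<open>Cochains on index sequences\<close>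

text \<open>The alternating sum over all deletions of one entry: the simplicial coboundary, with
  augmentation in degree \<open>0\<close>.\<close>

fun coboundary :: "('i list \<Rightarrow> 'f::field) \<Rightarrow> 'i list \<Rightarrow> 'f" where
  "coboundary f [] = 0"
| "coboundary f (y # ys) = f ys - coboundary (\<lambda>zs. f (y # zs)) ys"

lemma coboundary_add: "coboundary (\<lambda>ys. f ys + g ys) ys = coboundary f ys + coboundary g ys"
  by (induction ys arbitrary: f g) auto

lemma coboundary_diff: "coboundary (\<lambda>ys. f ys - g ys) ys = coboundary f ys - coboundary g ys"
  by (induction ys arbitrary: f g) auto

lemma coboundary_scale: "coboundary (\<lambda>ys. c * f ys) ys = c * coboundary f ys"
  by (induction ys arbitrary: f) (auto simp: algebra_simps)

lemma coboundary_0 [simp]: "coboundary (\<lambda>ys. 0) ys = 0"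
  using coboundary_scale[of 0 "\<lambda>_. 0"] by simp

text \<open>Splitting off the head \<open>y\<close>, the two terms \<open>coboundary f ys\<close>
  cancel and the double coboundary of \<open>\<lambda>zs. f (y # zs)\<close> remains.\<close>

lemma coboundary_coboundary: "coboundary (coboundary f) ys = 0"
  by (induction ys arbitrary: f) (auto simp: coboundary_diff)

text \<open>A deletion shortens the list by one, so the sign of the degree anticommutes with the
  coboundary.\<close>

lemma coboundary_alternating:
  "coboundary (\<lambda>ys. (- 1) ^ length ys * f ys) ys = - ((- 1) ^ length ys * coboundary f ys)"
proof (induction ys arbitrary: f)
  case (Cons y ys)
  have "coboundary (\<lambda>zs. (- 1) ^ length (y # zs) * f (y # zs)) ys
      = coboundary (\<lambda>zs. (- 1) ^ length zs * (- f (y # zs))) ys"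
    by simp
  also have "\<dots> = (- 1) ^ length ys * coboundary (\<lambda>zs. f (y # zs)) ys"
    using coboundary_scale[of "- 1" "\<lambda>zs. f (y # zs)" ys] by (simp only: Cons) simp
  finally show ?case by (simp add: algebra_simps)
qed simp

text \<open>The recursion seen from the other end, where \<open>last_proj\<close> looks.\<close>

lemma coboundary_snoc:
  "coboundary f (ys @ [y]) = coboundary (\<lambda>zs. f (zs @ [y])) ys + (- 1) ^ length ys * f ys"
  by (induction ys arbitrary: f) auto

text \<open>Normalized cochains vanish on degenerate simplices, here lists with equal neighbours.
  The degree counts vertices, so it exceeds the simplicial dimension by one.\<close>

definition normalized :: "nat \<Rightarrow> ('i list \<Rightarrow> 'f::field) \<Rightarrow> bool" where
  "normalized n f \<longleftrightarrow> (\<forall>ys. f ys \<noteq> 0 \<longrightarrow> length ys = n \<and> distinct_adj ys)"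

lemma coboundary_eq_0_length:
  "(\<And>zs. Suc (length zs) = length ys \<Longrightarrow> f zs = 0) \<Longrightarrow> coboundary f ys = 0"
proof (induction ys arbitrary: f)
  case (Cons y ys)
  have "coboundary (\<lambda>zs. f (y # zs)) ys = 0"
    by (rule Cons.IH) (simp add: Cons.prems)
  then show ?case by (simp add: Cons.prems)
qed simp

text \<open>Deleting either of two equal neighbours gives the same list with opposite signs; any
  other deletion leaves a repetition.\<close>

lemma coboundary_eq_0_repeating:
  "(\<And>zs. \<not> distinct_adj zs \<Longrightarrow> f zs = 0) \<Longrightarrow> \<not> distinct_adj ys \<Longrightarrow> coboundary f ys = 0"
proof (induction ys arbitrary: f)
  case (Cons y ys)
  show ?case
  proof (cases "distinct_adj ys")
    case True
    then obtain zs where ys: "ys = y # zs"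
      using Cons.prems(2) by (cases ys) auto
    have "(\<lambda>zs. f (y # y # zs)) = (\<lambda>_. 0)"
      by (rule ext) (simp add: Cons.prems(1))
    then show ?thesis by (simp add: ys)
  next
    case False
    have "coboundary (\<lambda>zs. f (y # zs)) ys = 0"
      using False by (rule Cons.IH[rotated]) (metis Cons.prems(1) distinct_adj_ConsD)
    then show ?thesis by (simp add: Cons.prems(1) False)
  qed
qed simp

lemma normalized_coboundary:
  assumes "normalized n f"
  shows "normalized (Suc n) (coboundary f)"
  unfolding normalized_def
proof (intro allI impI conjI)
  fix ys assume ys: "coboundary f ys \<noteq> 0"
  show "length ys = Suc n"
    using ys coboundary_eq_0_length[of ys f] assms unfolding normalized_def by fastforce
  show "distinct_adj ys"
    using ys coboundary_eq_0_repeating[of f ys] assms unfolding normalized_def by blast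
qed

text \<open>The contracting homotopy prepends a fixed index.\<close>

lemma coboundary_exact:
  fixes f :: "'i list \<Rightarrow> 'f::field"
  assumes "normalized (Suc n) f" "\<And>ys. coboundary f ys = 0"
  obtains g where "normalized n g" "f = coboundary g"
proof
  \<comment> \<open>\<open>undefined\<close> stands for an arbitrary vertex of the simplex.\<close>
  define g where "g zs = f (undefined # zs)" for zs
  show "normalized n g"
    using assms(1) unfolding normalized_def g_def by (metis distinct_adj_ConsD length_Cons nat.inject)
  show "f = coboundary g"
  proof
    fix ys
    show "f ys = coboundary g ys"
      \<comment> \<open>The recursion at the cone over \<open>ys\<close> reads
        \<open>f ys - coboundary g ys = 0\<close>.\<close>
      using assms(2)[of "undefined # ys"] by (simp add: g_def[abs_def])
  qed
qed


section \<open>The regular representation on cochains\<close>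

text \<open>On a cochain of degree \<open>n\<close> the paper's \<open>\<partial> x = x + (- 1) ^ n * star x\<close> forces
  \<open>star x = (- 1) ^ n * (\<partial> x - x)\<close>. Since the coboundary squares to zero, this is an
  involution, so that the starred idempotents can be defined as the conjugates of the nonstarred
  ones.\<close>

definition cochain_star :: "('i list \<Rightarrow> 'f::field) \<Rightarrow> 'i list \<Rightarrow> 'f" where
  "cochain_star f ys = - ((- 1) ^ length ys * (f ys + coboundary f ys))"

text \<open>By anticommutation the coboundary terms of the two applications carry opposite signs and
  cancel, while the signs of \<open>f\<close> itself multiply to \<open>1\<close>.\<close>

lemma cochain_star_cochain_star [simp]: "cochain_star (cochain_star f) = f"
proof
  fix ys
  have "coboundary (cochain_star f) ys
      = - coboundary (\<lambda>ys. (- 1) ^ length ys * (f ys + coboundary f ys)) ys"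
    using coboundary_scale[of "- 1"] unfolding cochain_star_def by simp
  also have "\<dots> = (- 1) ^ length ys * coboundary f ys"
    by (simp add: coboundary_alternating coboundary_add coboundary_coboundary)
  finally have "coboundary (cochain_star f) ys = (- 1) ^ length ys * coboundary f ys" .
  then show "cochain_star (cochain_star f) ys = f ys"
    by (simp add: cochain_star_def[of "cochain_star f"]) (simp add: cochain_star_def algebra_simps flip: power_add)
qed

text \<open>On the empty list \<open>last\<close> takes an unspecified value, which is harmless: the relations hold
  there as well.\<close>

definition last_proj :: "'i \<Rightarrow> ('i list \<Rightarrow> 'f::field) \<Rightarrow> 'i list \<Rightarrow> 'f" where
  "last_proj j f ys = (if last ys = j then f ys else 0)"

fun cochain_act :: "'i generator \<Rightarrow> ('i list \<Rightarrow> 'f::field) \<Rightarrow> 'i list \<Rightarrow> 'f" where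
  "cochain_act (E j) f = last_proj j f"
| "cochain_act (Estar j) f = cochain_star (last_proj j (cochain_star f))"

definition scale_fun :: "'f::field \<Rightarrow> ('i list \<Rightarrow> 'f) \<Rightarrow> 'i list \<Rightarrow> 'f" where
  "scale_fun c f ys = c * f ys"

lemma sum_fun_apply: "(\<Sum>x\<in>S. f x) y = (\<Sum>x\<in>S. f x y :: 'f::field)"
  by (induction S rule: infinite_finite_induct) auto

lemma cochain_star_add: "cochain_star (f + g) = cochain_star f + cochain_star g"
  by (auto simp: cochain_star_def coboundary_add plus_fun_def algebra_simps)

lemma cochain_star_0 [simp]: "cochain_star 0 = 0"
  using cochain_star_add[of 0 0] by simp

lemma cochain_star_sum: "cochain_star (\<Sum>x\<in>S. f x) = (\<Sum>x\<in>S. cochain_star (f x))"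
  by (induction S rule: infinite_finite_induct) (simp_all only: sum.infinite sum.empty sum.insert cochain_star_add cochain_star_0 not_False_eq_True)

lemma cochain_star_scale: "cochain_star (scale_fun c f) = scale_fun c (cochain_star f)"
  by (auto simp: cochain_star_def scale_fun_def[abs_def] coboundary_scale algebra_simps)

lemma last_proj_add: "last_proj j (f + g) = last_proj j f + last_proj j g"
  by (auto simp: last_proj_def)

lemma last_proj_scale: "last_proj j (scale_fun c f) = scale_fun c (last_proj j f)"
  by (auto simp: last_proj_def scale_fun_def)

lemma last_proj_last_proj: "last_proj j (last_proj i f) = (if i = j then last_proj i f else 0)"
  by (auto simp: last_proj_def)

lemma sum_last_proj: "(\<Sum>j\<in>UNIV. last_proj j f) = (f :: 'i::finite list \<Rightarrow> _)"
  by (auto simp: last_proj_def sum_fun_apply)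

interpretation cochain: right_module scale_fun "cochain_act :: 'i::finite generator \<Rightarrow> _"
proof unfold_locales
  fix g :: "'i generator" and u v :: "'i list \<Rightarrow> 'f::field" and c
  show "cochain_act g (u + v) = cochain_act g u + cochain_act g v"
    by (cases g) (auto simp: last_proj_add cochain_star_add)
  show "cochain_act g (scale_fun c u) = scale_fun c (cochain_act g u)"
    by (cases g) (auto simp: last_proj_scale cochain_star_scale)
qed (auto simp: scale_fun_def algebra_simps last_proj_last_proj sum_last_proj
    simp flip: cochain_star_sum)

text \<open>The coefficients of \<open>1\<close>, the sum of the nonstarred one-letter
  words.\<close>

definition unit_cochain :: "'i list \<Rightarrow> 'f::field" where
  "unit_cochain ys = (if length ys = 1 then 1 else 0)"

text \<open>Meant to read off the coefficients of \<open>x\<close> with respect to the nonrepeating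
  words ending nonstarred; \<open>coord_word\<close> confirms this.\<close>

definition coord :: "('i::finite, 'f::field) alg \<Rightarrow> 'i list \<Rightarrow> 'f" where
  "coord = cochain.orbit unit_cochain"

lemma coord_1: "coord 1 = unit_cochain"
  by (simp add: coord_def cochain.orbit_one)

lemma coord_mult_gen: "coord (x * gen g) = cochain_act g (coord x)"
  by (simp add: coord_def cochain.orbit_mult cochain.orbit_gen)

lemma coord_add: "coord (x + y) = coord x + coord y"
  by (simp add: coord_def cochain.orbit_add)

lemma coord_0 [simp]: "coord 0 = 0"
  using coord_add[of 0 0] by simp

lemma coord_sum: "coord (\<Sum>x\<in>S. f x) = (\<Sum>x\<in>S. coord (f x))"
  by (induction S rule: infinite_finite_induct) (auto simp: coord_add)

lemma coord_scale: "coord (scale c x) ys = c * coord x ys"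
  by (simp add: coord_def cochain.orbit_scale scale_fun_def)

lemma cochain_star_unit_cochain:
  "cochain_star unit_cochain = (unit_cochain :: 'i list \<Rightarrow> 'f::field)"
proof
  fix ys :: "'i list"
  consider "ys = []" | y where "ys = [y]" | y z zs where "ys = y # z # zs"
    by (metis list.exhaust)
  then show "cochain_star unit_cochain ys = (unit_cochain ys :: 'f)"
  proof cases
    case 3
    \<comment> \<open>With two entries the two deletions cancel; with more, no deletion leaves a
      single entry.\<close>
    have "coboundary unit_cochain ys = (0 :: 'f)"
    proof (cases "zs = []")
      case False
      then show ?thesis
        by (intro coboundary_eq_0_length) (auto simp: unit_cochain_def 3)
    qed (simp add: 3 unit_cochain_def)
    then show ?thesis by (simp add: cochain_star_def 3 unit_cochain_def)
  qed (auto simp: cochain_star_def unit_cochain_def)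
qed

section \<open>Words with prescribed indices\<close>

text \<open>The flag tells whether the last factor is starred.\<close>

fun word_letters :: "bool \<Rightarrow> 'i list \<Rightarrow> 'i generator list" where
  "word_letters b [] = []"
| "word_letters b (y # ys) = (if b = even (length ys) then Estar y else E y) # word_letters b ys"

definition word :: "bool \<Rightarrow> 'i list \<Rightarrow> ('i::finite, 'f::field) alg" where
  "word b ys = prod_list (map gen (word_letters b ys))"

lemma word_Nil [simp]: "word b [] = 1"
  by (simp add: word_def)

lemma word_Cons: "word b (y # ys) = gen (if b = even (length ys) then Estar y else E y) * word b ys"
  by (simp add: word_def)

lemma word_snoc: "word b (ys @ [y]) = word (\<not> b) ys * gen (if b then Estar y else E y)"
  by (induction ys) (auto simp: word_Cons mult.assoc)

lemma star_word: "star (word b ys) = word (\<not> b) ys"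
  by (induction ys) (auto simp: word_Cons star_mult)

text \<open>Both flags are treated in one induction on the last letter, since removing it flips the
  flag. A single identity for \<open>last_proj\<close> settles both, the starred case being its
  image under \<open>cochain_star\<close>.\<close>

lemma coord_word:
  fixes ys :: "'i::finite list"
  assumes "ys \<noteq> []" "distinct_adj ys"
  shows "coord (word False ys) = (\<lambda>zs. if zs = ys then 1 else 0 :: 'f::field)"
    and "coord (word True ys) = cochain_star (\<lambda>zs. if zs = ys then 1 else 0 :: 'f::field)"
proof -
  let ?d = "\<lambda>ys zs :: 'i list. if zs = ys then 1 else 0 :: 'f"
  have "coord (word False ys) = ?d ys \<and> coord (word True ys) = cochain_star (?d ys)"
    using assms
  proof (induction ys rule: rev_induct)
    case (snoc j ys)
    show ?case
    proof (cases "ys = []")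
      case True
      have "last_proj j unit_cochain = ?d [j]"
      proof
        fix zs show "last_proj j unit_cochain zs = ?d [j] zs"
          by (cases zs rule: rev_cases) (auto simp: last_proj_def unit_cochain_def)
      qed
      moreover have "coord (word b [j]) = cochain_act (if b then Estar j else E j) (unit_cochain :: 'i list \<Rightarrow> 'f)" for b
        using coord_mult_gen[of "1 :: ('i, 'f) alg"] by (simp add: word_Cons coord_1)
      ultimately show ?thesis
        by (simp add: True cochain_star_unit_cochain)
    next
      case False
      then have "last ys \<noteq> j" "distinct_adj ys"
        using snoc.prems by (auto simp: distinct_adj_append_iff)
      have "last_proj j (cochain_star (?d ys)) = ?d (ys @ [j])"
      proof
        fix zs
        show "last_proj j (cochain_star (?d ys)) zs = ?d (ys @ [j]) zs"
        proof (cases zs rule: rev_cases)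
          case Nil
          \<comment> \<open>\<open>last []\<close> may happen to be \<open>j\<close>, but the
            cochain vanishes at the empty list.\<close>
          with False show ?thesis by (simp add: last_proj_def cochain_star_def)
        next
          case (snoc us u)
          \<comment> \<open>As \<open>last ys \<noteq> j\<close>, only deleting the final
            \<open>j\<close> can leave \<open>ys\<close>; the sign of this deletion then cancels the
            one in \<open>cochain_star\<close>.\<close>
          have "coboundary (?d ys) (us @ [j]) = (- 1) ^ length us * ?d ys us"
          proof -
            have "(\<lambda>zs. ?d ys (zs @ [j])) = (\<lambda>_. 0)"
              using \<open>last ys \<noteq> j\<close> by (intro ext) auto
            then show ?thesis by (simp add: coboundary_snoc)
          qed
          then show ?thesis
            using snoc \<open>last ys \<noteq> j\<close>
            by (auto simp: last_proj_def cochain_star_def simp flip: power_add)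
        qed
      qed
      then show ?thesis
        using snoc.IH[OF False \<open>distinct_adj ys\<close>]
        by (simp add: word_snoc coord_mult_gen)
    qed
  qed simp
  then show "coord (word False ys) = ?d ys" "coord (word True ys) = cochain_star (?d ys)"
    by auto
qed

section \<open>Sums of words with cochain coefficients, and their coboundaries\<close>

definition letter :: "bool \<Rightarrow> nat \<Rightarrow> 'i::finite \<Rightarrow> ('i, 'f::field) alg" where
  "letter b n y = gen (if b = even n then Estar y else E y)"

lemma word_Cons_letter: "word b (y # ys) = letter b (length ys) y * word b ys"
  by (simp add: word_Cons letter_def)

lemma letter_Suc: "letter b (Suc n) = letter (\<not> b) n"
  by (auto simp: letter_def fun_eq_iff)

lemma letter_mult: "letter b n y * letter b n z = (if y = z then letter b n y else 0)"
  by (simp add: letter_def gen_E_mult gen_Estar_mult)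

lemma sum_letter: "(\<Sum>y\<in>UNIV. letter b n y) = 1"
  by (cases "b = even n") (simp_all add: letter_def sum_gen_E sum_gen_Estar)

text \<open>Realizes a cochain as an element of the algebra; on normalized cochains of positive
  degree and for words ending nonstarred, \<open>coord\<close> inverts it.\<close>

definition word_sum :: "bool \<Rightarrow> nat \<Rightarrow> ('i::finite list \<Rightarrow> 'f::field) \<Rightarrow> ('i, 'f) alg" where
  "word_sum b n f = (\<Sum>ys | length ys = n. scale (f ys) (word b ys))"

lemma finite_length_eq: "finite {ys :: 'i::finite list. length ys = n}"
  using finite_lists_length_eq[of "UNIV :: 'i set" n] by simp

lemma word_sum_0: "word_sum b 0 f = scale (f []) 1"
  by (simp add: word_sum_def)

lemma word_sum_Suc:
  "word_sum b (Suc n) f = (\<Sum>y\<in>UNIV. letter b n y * word_sum b n (\<lambda>ys. f (y # ys)))"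
proof -
  have "{ys :: 'a list. length ys = Suc n} = (\<lambda>(y, ys). y # ys) ` (UNIV \<times> {ys. length ys = n})"
    by (auto simp: length_Suc_conv image_iff)
  moreover have "inj_on (\<lambda>(y, ys). y # ys) A" for A :: "('a \<times> 'a list) set"
    by (auto simp: inj_on_def)
  ultimately have "word_sum b (Suc n) f
      = (\<Sum>y\<in>UNIV. \<Sum>ys | length ys = n. scale (f (y # ys)) (word b (y # ys)))"
    by (simp add: word_sum_def sum.reindex sum.cartesian_product case_prod_unfold)
  also have "\<dots> = (\<Sum>y\<in>UNIV. letter b n y * word_sum b n (\<lambda>ys. f (y # ys)))"
    by (simp add: word_sum_def word_Cons_letter scale_mult_right sum_distrib_left)
  finally show ?thesis .
qed

lemma word_sum_diff: "word_sum b n (\<lambda>ys. f ys - g ys) = word_sum b n f - word_sum b n g"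
  by (simp add: word_sum_def alg.scale_left_diff_distrib sum_subtractf)

lemma word_sum_add: "word_sum b n (\<lambda>ys. f ys + g ys) = word_sum b n f + word_sum b n g"
  by (simp add: word_sum_def alg.scale_left_distrib sum.distrib)

lemma word_sum_scale: "word_sum b n (\<lambda>ys. c * f ys) = scale c (word_sum b n f)"
  by (simp add: word_sum_def alg.scale_sum_right)

lemma word_sum_zero [simp]: "word_sum b n (\<lambda>ys. 0) = 0"
  by (simp add: word_sum_def)

lemma star_word_sum: "star (word_sum b n f) = word_sum (\<not> b) n f"
  by (simp add: word_sum_def star_sum star_scale star_word)

text \<open>In the term where the head is deleted, the first letter no longer affects the
  coefficient, so it sums to \<open>1\<close> and disappears.\<close>

lemma word_sum_coboundary_Suc:
  "word_sum b (Suc (Suc n)) (coboundary f) = word_sum b (Suc n) f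
    - (\<Sum>y\<in>UNIV. letter b (Suc n) y * word_sum b (Suc n) (coboundary (\<lambda>ys. f (y # ys))))"
  by (subst word_sum_Suc)
    (simp add: word_sum_diff right_diff_distrib sum_subtractf sum_letter flip: sum_distrib_right)

lemma normalized_Cons: "normalized (Suc n) f \<Longrightarrow> normalized n (\<lambda>ys. f (y # ys))"
  unfolding normalized_def by (metis distinct_adj_ConsD length_Cons nat.inject)

lemma minus_one_power_mult: "(- 1) ^ n * x = (if even n then x else - x :: 'a::ring_1)"
  by simp

text \<open>By induction the inner sum splits into two outer terms. One is killed by the letter in
  front of it, the other absorbs that letter and becomes a sum of longer words.\<close>

lemma word_sum_coboundary:
  assumes "n \<ge> 1" "normalized n f"
  shows "word_sum b (Suc n) (coboundary f) = word_sum b n f + (- 1) ^ n * word_sum (\<not> b) n f"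
  using assms
proof (induction n arbitrary: f rule: nat_induct_at_least)
  case base
  \<comment> \<open>In length zero the flag has no effect; \<open>\<not> b\<close> is chosen so that
    the sum over \<open>y\<close> reassembles by \<open>word_sum_Suc\<close>.\<close>
  have "word_sum b 1 (coboundary (\<lambda>ys. f (y # ys))) = word_sum (\<not> b) 0 (\<lambda>ys. f (y # ys))" for y
    by (simp add: word_sum_Suc word_sum_0 sum_letter flip: sum_distrib_right)
  then show ?case
    by (simp add: word_sum_coboundary_Suc letter_Suc flip: word_sum_Suc)
next
  case (Suc n)
  then obtain m where n: "n = Suc m" by (cases n) auto
  have repeat: "f (y # y # zs) = 0" for y zs
    using Suc.prems unfolding normalized_def by (metis distinct_adj_Cons_Cons)
  \<comment> \<open>The words of the sum begin with a letter of the same family as the factor in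
    front: different indices give zero by orthogonality, equal ones have coefficient zero by
    \<open>repeat\<close>.\<close>
  have 0: "letter (\<not> b) n y * word_sum b n (\<lambda>ys. f (y # ys)) = 0" for y
    by (simp add: n word_sum_Suc letter_Suc sum_distrib_left letter_mult repeat
        if_distrib[of "\<lambda>x. x * _"] flip: mult.assoc cong: if_cong)
  have "(\<Sum>y\<in>UNIV. letter b (Suc n) y * word_sum b (Suc n) (coboundary (\<lambda>ys. f (y # ys))))
      = (- 1) ^ n * word_sum (\<not> b) (Suc n) f"
    by (simp add: Suc.IH[OF normalized_Cons[OF Suc.prems]] distrib_left 0 minus_one_power_mult
        sum_negf letter_Suc[of b n] flip: word_sum_Suc)
  then show ?case
    by (simp add: word_sum_coboundary_Suc)
qed

section \<open>Nonrepeating words and the spaces \<open>A_sub n\<close>\<close>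

lemma word_letters_map_index:
  "is_word gs \<Longrightarrow> gs = word_letters (starred (last gs)) (map index gs)"
proof (induction gs rule: induct_list012)
  case (3 g h gs)
  then have IH: "h # gs = word_letters (starred (last (h # gs))) (map index (h # gs))"
    by (simp add: is_word_def)
  have "starred g \<noteq> starred h" using 3 by (simp add: is_word_def)
  moreover have "h = (if starred (last (h # gs)) = even (length gs) then Estar (index h) else E (index h))"
    using IH by simp
  ultimately have "g = (if starred (last (h # gs)) = odd (length gs) then Estar (index g) else E (index g))"
    by (cases g; cases h) (auto split: if_splits)
  with IH show ?case by simp
next
  case (2 g)
  then show ?case by (cases g) auto
qed (simp add: is_word_def)

lemma index_word_letters: "map index (word_letters b ys) = ys"
  by (induction ys) auto

lemma word_letters_eq_Nil_iff [simp]: "word_letters b ys = [] \<longleftrightarrow> ys = []"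
  by (cases ys) auto

lemma last_word_letters: "ys \<noteq> [] \<Longrightarrow> starred (last (word_letters b ys)) = b"
  by (induction ys) auto

lemma is_word_word_letters: "ys \<noteq> [] \<Longrightarrow> is_word (word_letters b ys)"
  by (induction ys rule: induct_list012) (auto simp: is_word_def)

lemma nonrepeating_iff: "nonrepeating gs \<longleftrightarrow> distinct_adj (map index gs)"
  by (simp add: nonrepeating_def distinct_adj_def successively_map)

definition nr_lists :: "nat \<Rightarrow> 'i list set" where
  "nr_lists n = {ys. length ys = n \<and> distinct_adj ys}"

lemma A_sub_eq_span:
  assumes "n \<ge> 1"
  shows "A_sub n = alg.span (word False ` nr_lists n)"
proof -
  have "{prod_list (map gen gs) | gs. is_word gs \<and> nonrepeating gs \<and> length gs = n \<and> \<not> starred (last gs)}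
      = (word False ` nr_lists n :: ('a, 'b) alg set)" (is "?L = ?R")
  proof
    show "?L \<subseteq> ?R"
    proof safe
      fix gs :: "'a generator list"
      assume gs: "is_word gs" "nonrepeating gs" "n = length gs" "\<not> starred (last gs)"
      then have "prod_list (map gen gs) = word False (map index gs)"
        using word_letters_map_index[of gs] by (simp add: word_def)
      then show "prod_list (map gen gs) \<in> word False ` nr_lists (length gs)"
        using gs by (auto simp: nr_lists_def nonrepeating_iff)
    qed
    show "?R \<subseteq> ?L"
    proof safe
      fix ys :: "'a list" assume ys: "ys \<in> nr_lists n"
      with assms have "ys \<noteq> []" by (auto simp: nr_lists_def)
      moreover have "length (word_letters False ys) = length ys"
        by (metis index_word_letters length_map)
      ultimately show "\<exists>gs. word False ys = prod_list (map gen gs) \<and> is_word gs \<and> nonrepeating gs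
          \<and> length gs = n \<and> \<not> starred (last gs)"
        using ys
        by (intro exI[of _ "word_letters False ys"])
          (auto simp: word_def is_word_word_letters nonrepeating_iff index_word_letters
            last_word_letters nr_lists_def)
    qed
  qed
  then show ?thesis by (simp add: A_sub_def)
qed

lemma word_sum_single:
  "length ys = n \<Longrightarrow> word_sum b n (\<lambda>zs. if zs = ys then 1 else 0) = word b ys"
  by (simp add: word_sum_def if_distrib[of "\<lambda>c. scale c _"] finite_length_eq cong: if_cong)

text \<open>\<open>word_sum\<close> is linear in the cochain and sends indicators to words. In
  degree \<open>0\<close> the two sides differ: \<open>A_sub 0\<close> is zero, but the sums give
  all scalars.\<close>

lemma A_sub_eq_word_sum:
  assumes "n \<ge> 1"
  shows "A_sub n = word_sum False n ` {f :: 'i::finite list \<Rightarrow> 'f::field. normalized n f}"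
proof
  have "alg.subspace (word_sum False n ` {f :: 'i list \<Rightarrow> 'f. normalized n f})"
  proof (rule alg.subspaceI)
    show "0 \<in> word_sum False n ` {f :: 'i list \<Rightarrow> 'f. normalized n f}"
      by (rule image_eqI[of _ _ "\<lambda>_. 0"]) (simp_all add: normalized_def)
  next
    fix x y assume "x \<in> word_sum False n ` {f :: 'i list \<Rightarrow> 'f. normalized n f}"
      "y \<in> word_sum False n ` {f :: 'i list \<Rightarrow> 'f. normalized n f}"
    then obtain f g where "normalized n f" "normalized n g"
      "x = word_sum False n f" "y = word_sum False n g" by blast
    then show "x + y \<in> word_sum False n ` {f :: 'i list \<Rightarrow> 'f. normalized n f}"
      by (intro image_eqI[of _ _ "\<lambda>ys. f ys + g ys"])
        (simp_all add: word_sum_add normalized_def, metis add.right_neutral)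
  next
    fix x c assume "x \<in> word_sum False n ` {f :: 'i list \<Rightarrow> 'f. normalized n f}"
    then obtain f where "normalized n f" "x = word_sum False n f" by blast
    then show "scale c x \<in> word_sum False n ` {f :: 'i list \<Rightarrow> 'f. normalized n f}"
      by (intro image_eqI[of _ _ "\<lambda>ys. c * f ys"])
        (simp_all add: word_sum_scale normalized_def)
  qed
  moreover have "word False ` nr_lists n \<subseteq> word_sum False n ` {f :: 'i list \<Rightarrow> 'f. normalized n f}"
  proof safe
    fix ys :: "'i list" assume "ys \<in> nr_lists n"
    then show "word False ys \<in> word_sum False n ` {f :: 'i list \<Rightarrow> 'f. normalized n f}"
      by (intro image_eqI[of _ _ "\<lambda>zs. if zs = ys then 1 else 0"])
        (simp_all add: word_sum_single nr_lists_def normalized_def)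
  qed
  ultimately show "A_sub n \<subseteq> word_sum False n ` {f :: 'i list \<Rightarrow> 'f. normalized n f}"
    by (simp add: A_sub_eq_span[OF assms] alg.span_minimal)
  show "word_sum False n ` {f :: 'i list \<Rightarrow> 'f. normalized n f} \<subseteq> A_sub n"
  proof safe
    fix f :: "'i list \<Rightarrow> 'f" assume f: "normalized n f"
    have "scale (f ys) (word False ys) \<in> A_sub n" for ys
    proof (cases "f ys = 0")
      case True
      then show ?thesis by (simp add: A_sub_def alg.span_zero)
    next
      case False
      then have "ys \<in> nr_lists n" using f by (simp add: normalized_def nr_lists_def)
      then show ?thesis
        by (simp add: A_sub_eq_span[OF assms] alg.span_scale alg.span_base)
    qed
    then show "word_sum False n f \<in> A_sub n"
      unfolding word_sum_def A_sub_def by (intro alg.span_sum) auto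
  qed
qed

lemma coord_word_sum:
  assumes "n \<ge> 1" "normalized n f"
  shows "coord (word_sum False n f) = f"
proof
  fix ys
  have "coord (word_sum False n f) ys = (\<Sum>zs | length zs = n. f zs * coord (word False zs) ys)"
    by (simp add: word_sum_def coord_sum sum_fun_apply coord_scale)
  also have "\<dots> = (\<Sum>zs | length zs = n. if zs = ys then f zs else 0)"
  proof (rule sum.cong)
    fix zs :: "'a list" assume "zs \<in> {zs. length zs = n}"
    then have "zs \<noteq> []" using assms(1) by auto
    \<comment> \<open>Nonrepetition of \<open>zs\<close> is guaranteed only where
      \<open>f zs\<close> is nonzero.\<close>
    then have "coord (word False zs) = (\<lambda>us. if us = zs then 1 else 0 :: 'b)" if "f zs \<noteq> 0"
      using that assms(2) by (intro coord_word(1)) (auto simp: normalized_def)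
    then show "f zs * coord (word False zs) ys = (if zs = ys then f zs else 0)"
      by (cases "f zs = 0") auto
  qed simp
  also have "\<dots> = f ys"
    using assms(2) by (auto simp: finite_length_eq normalized_def)
  finally show "coord (word_sum False n f) ys = f ys" .
qed

section \<open>The nonrepeating words ending nonstarred form a basis\<close>

definition nr_words :: "('i::finite, 'f::field) alg set" where
  "nr_words = word False ` {ys. ys \<noteq> [] \<and> distinct_adj ys}"

lemma A_sub_subset_span: "n \<ge> 1 \<Longrightarrow> A_sub n \<subseteq> alg.span nr_words"
  unfolding A_sub_eq_span nr_words_def by (intro alg.span_mono) (auto simp: nr_lists_def)

lemma inj_on_word:
  "inj_on (word False :: _ \<Rightarrow> ('i::finite, 'f::field) alg) {ys. ys \<noteq> [] \<and> distinct_adj ys}"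
proof (rule inj_onI)
  fix ys zs :: "'i list"
  assume *: "ys \<in> {ys. ys \<noteq> [] \<and> distinct_adj ys}" "zs \<in> {ys. ys \<noteq> [] \<and> distinct_adj ys}"
    and eq: "(word False ys :: ('i, 'f) alg) = word False zs"
  have "(1 :: 'f) = coord (word False ys) ys" using * by (simp add: coord_word(1))
  also have "\<dots> = (if ys = zs then 1 else 0)" unfolding eq using * by (simp add: coord_word(1))
  finally show "ys = zs" by (simp split: if_splits)
qed

text \<open>Applying \<open>coord\<close> to a linear relation and evaluating at the index sequence
  of one word isolates its coefficient.\<close>

lemma independent_nr_words: "alg.independent (nr_words :: ('i::finite, 'f::field) alg set)"
  unfolding alg.independent_explicit_module
proof (intro allI impI)
  fix t :: "('i, 'f) alg set" and u v
  assume t: "finite t" "t \<subseteq> nr_words" "(\<Sum>v\<in>t. scale (u v) v) = 0" "v \<in> t"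
  then obtain ys where ys: "v = word False ys" "ys \<noteq> []" "distinct_adj ys"
    unfolding nr_words_def by blast
  have "0 = coord (\<Sum>v\<in>t. scale (u v) v) ys" using t by simp
  also have "\<dots> = (\<Sum>w\<in>t. u w * coord w ys)"
    by (simp add: coord_sum sum_fun_apply coord_scale)
  also have "\<dots> = (\<Sum>w\<in>t. if w = v then u w else 0)"
  proof (rule sum.cong)
    fix w assume "w \<in> t"
    then obtain zs where zs: "w = word False zs" "zs \<noteq> []" "distinct_adj zs"
      using t unfolding nr_words_def by blast
    then have "w = v \<longleftrightarrow> zs = ys"
      unfolding zs(1) ys(1) using ys by (intro inj_on_eq_iff[OF inj_on_word]) auto
    then show "u w * coord w ys = (if w = v then u w else 0)"
      using zs by (auto simp: coord_word(1))
  qed simp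
  also have "\<dots> = u v" using t by simp
  finally show "u v = 0" by simp
qed

lemma one_eq_word_sum: "1 = word_sum False 1 unit_cochain"
  by (simp add: word_sum_Suc word_sum_0 unit_cochain_def letter_def sum_gen_E)

lemma normalized_unit_cochain: "normalized 1 unit_cochain"
  by (auto simp: normalized_def unit_cochain_def length_Suc_conv split: if_splits)

text \<open>\<open>word_sum_coboundary\<close> for the indicator cochain of a word, solved for the
  starred term, expresses \<open>star w\<close> through \<open>w\<close> and an element of
  \<open>A_sub (Suc n)\<close>.\<close>

lemma star_span_nr_words:
  assumes "x \<in> alg.span nr_words"
  shows "star x \<in> alg.span nr_words"
proof -
  have "star w \<in> alg.span nr_words" if w: "w \<in> nr_words" for w :: "('i::finite, 'f::field) alg"
  proof -
    obtain ys where ys: "w = word False ys" "ys \<noteq> []" "distinct_adj ys"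
      using w unfolding nr_words_def by blast
    define n and f :: "'i list \<Rightarrow> 'f"
      where "n = length ys" and "f zs = (if zs = ys then 1 else 0)" for zs
    have n: "n \<ge> 1" using ys by (simp add: n_def Suc_le_eq)
    have f: "normalized n f" using ys by (simp add: normalized_def f_def n_def)
    have "word_sum False (Suc n) (coboundary f) \<in> A_sub (Suc n)"
      using normalized_coboundary[OF f] by (simp add: A_sub_eq_word_sum)
    then have *: "word_sum False (Suc n) (coboundary f) \<in> alg.span nr_words"
      using A_sub_subset_span[of "Suc n"] by auto
    have w_eq: "word_sum False n f = w"
      using word_sum_single[of ys n] by (simp add: ys f_def[abs_def] n_def)
    have "star w = (- 1) ^ n * (word_sum False (Suc n) (coboundary f) - w)"
      using star_word_sum[of False n f] word_sum_coboundary[OF n f, of False]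
      by (simp add: w_eq minus_one_power_mult)
    then show ?thesis
      using * alg.span_base[OF w]
      by (auto simp: minus_one_power_mult intro: alg.span_diff alg.span_neg)
  qed
  with assms show ?thesis
    by (induction rule: alg.span_induct_alt)
      (auto simp: star_add star_scale alg.span_zero intro: alg.span_add alg.span_scale)
qed

text \<open>Right multiplication by \<open>gen (E j)\<close> keeps or kills a word ending
  nonstarred. Multiplication by \<open>gen (Estar j)\<close> reduces to this by conjugating with
  \<open>star\<close>, which preserves the span.\<close>

lemma span_nr_words: "x \<in> alg.span nr_words"
proof (induction x rule: alg_induct)
  case one
  have "1 \<in> A_sub 1"
    using normalized_unit_cochain by (auto simp: A_sub_eq_word_sum one_eq_word_sum)
  then show ?case using A_sub_subset_span[of 1] by auto
next
  case (gen x g)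
  have E: "y * gen (E j) \<in> alg.span nr_words" if "y \<in> alg.span nr_words" for y :: "('a, 'b) alg" and j
    using that
  proof (induction rule: alg.span_induct_alt)
    case (step c w y)
    then obtain ys where ys: "w = word False ys" "ys \<noteq> []" "distinct_adj ys"
      unfolding nr_words_def by blast
    then obtain zs i where "ys = zs @ [i]" by (cases ys rule: rev_cases) auto
    then have "w * gen (E j) = (if i = j then w else 0)"
      by (simp add: ys(1) word_snoc gen_E_mult mult.assoc)
    then show ?case
      using step by (auto simp: distrib_right scale_mult_left intro: alg.span_add alg.span_scale alg.span_base)
  qed (simp add: alg.span_zero)
  show ?case
  proof (cases g)
    case (Estar j)
    then have "x * gen g = star (star x * gen (E j))" by (simp add: star_mult)
    then show ?thesis by (simp add: star_span_nr_words E gen)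
  qed (use gen E in simp)
qed (simp add: alg.subspace_span)

section \<open>The boundary map as the coboundary\<close>

interpretation alg_pair: vector_space_pair scale scale
  by unfold_locales

text \<open>The description defining \<open>boundary\<close> has exactly one solution: independence
  of the basis words allows prescribing values on them, and spanning makes these values
  decisive.\<close>

lemma boundary_eq:
  fixes x :: "('i::finite, 'f::field) alg"
  assumes "n \<ge> 1" "x \<in> A_sub n"
  shows "boundary x = x + (- 1) ^ n * star x"
proof -
  let ?P = "\<lambda>D. Vector_Spaces.linear scale scale D \<and>
    (\<forall>n\<ge>1. \<forall>x\<in>A_sub n. D x = x + (- 1) ^ n * star (x :: ('i, 'f) alg))"
  \<comment> \<open>The length of a basis word is read off its index sequence, which is unique by
    \<open>inj_on_word\<close>.\<close>
  let ?len = "\<lambda>x. length (inv_into {ys. ys \<noteq> [] \<and> distinct_adj ys} (word False) x)"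
  obtain D where D: "Vector_Spaces.linear scale scale D"
    "\<And>x. x \<in> nr_words \<Longrightarrow> D x = x + (- 1) ^ ?len x * star (x :: ('i, 'f) alg)"
    using alg_pair.linear_independent_extend[OF independent_nr_words,
        of "\<lambda>x. x + (- 1) ^ ?len x * star x"] by blast
  have "D x = x + (- 1) ^ n * star x" if "n \<ge> 1" "x \<in> A_sub n" for n x
  proof -
    \<comment> \<open>For fixed \<open>n\<close> both sides are linear, so they need only be
      compared on the words of length \<open>n\<close>, where \<open>?len\<close> is
      \<open>n\<close>.\<close>
    have "Vector_Spaces.linear scale scale (\<lambda>x :: ('i, 'f) alg. x + (- 1) ^ n * star x)"
      by unfold_locales
        (simp_all add: star_add star_scale minus_one_power_mult alg.scale_right_distrib
          alg.scale_right_diff_distrib)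
    moreover have "x \<in> alg.span (word False ` nr_lists n)"
      using that by (simp add: A_sub_eq_span)
    moreover have "D w = w + (- 1) ^ n * star w" if "w \<in> word False ` nr_lists n" for w
    proof -
      from that obtain ys where ys: "w = word False ys" "ys \<in> nr_lists n" by blast
      with \<open>n \<ge> 1\<close> have "ys \<in> {ys. ys \<noteq> [] \<and> distinct_adj ys}"
        by (auto simp: nr_lists_def)
      then have "inv_into {ys. ys \<noteq> [] \<and> distinct_adj ys} (word False) w = ys" "w \<in> nr_words"
        unfolding ys(1) nr_words_def by (blast intro: inv_into_f_f[OF inj_on_word])+
      then show ?thesis using D(2)[of w] ys(2) by (simp add: nr_lists_def)
    qed
    ultimately show ?thesis using D(1) alg_pair.linear_eq_on by blast
  qed
  with D(1) have P: "?P D" by blast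
  have uniq: "D' = D" if "?P D'" for D'
  proof
    fix x :: "('i, 'f) alg"
    have "D' w = D w" if w: "w \<in> nr_words" for w
    proof -
      obtain ys where "w = word False ys" "ys \<noteq> []" "distinct_adj ys"
        using w unfolding nr_words_def by blast
      then have "length ys \<ge> 1" "w \<in> A_sub (length ys)"
        by (auto simp: A_sub_eq_span nr_lists_def Suc_le_eq intro!: alg.span_base)
      then show ?thesis using P \<open>?P D'\<close> by simp
    qed
    then show "D' x = D x"
      using alg_pair.linear_eq_on[of D' D x nr_words] span_nr_words P \<open>?P D'\<close> by blast
  qed
  have "boundary = D"
    unfolding boundary_def by (rule the_equality, rule P, rule uniq)
  with P assms show ?thesis by simp
qed

lemma boundary_word_sum:
  assumes "n \<ge> 1" "normalized n f"
  shows "boundary (word_sum False n f) = word_sum False (Suc n) (coboundary f)"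
proof -
  have "word_sum False n f \<in> A_sub n"
    using assms by (simp add: A_sub_eq_word_sum)
  then show ?thesis
    using assms by (simp add: boundary_eq[of n] word_sum_coboundary star_word_sum)
qed

text \<open>By \<open>coord_word_sum\<close> a nonzero normalized cochain gives a nonzero element,
  so the kernel of \<open>boundary\<close> consists of cocycles.\<close>

lemma boundary_word_sum_eq_0_iff:
  assumes "n \<ge> 1" "normalized n f"
  shows "boundary (word_sum False n f) = 0 \<longleftrightarrow> (\<forall>ys. coboundary f ys = 0)"
proof
  assume "boundary (word_sum False n f) = 0"
  then have "coord (word_sum False (Suc n) (coboundary f)) = 0"
    using assms by (simp add: boundary_word_sum)
  then show "\<forall>ys. coboundary f ys = 0"
    using assms by (simp add: coord_word_sum normalized_coboundary fun_eq_iff)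
next
  assume "\<forall>ys. coboundary f ys = 0"
  then have "coboundary f = (\<lambda>_. 0)" by auto
  then show "boundary (word_sum False n f) = 0"
    using assms by (simp add: boundary_word_sum)
qed

section \<open>Exactness, with the scalars as augmentation\<close>

lemma iota_eq_word_sum: "iota a = word_sum False 1 (\<lambda>ys. a * unit_cochain ys)"
  by (simp only: iota_eq_scale word_sum_scale flip: one_eq_word_sum)

theorem theorem7p14:
  fixes d :: nat
  assumes "d \<ge> 1" and "card (UNIV :: 'i::finite set) = d + 1"
  shows "range (iota :: 'f::field \<Rightarrow> ('i, 'f) alg) = {x \<in> A_sub 1. boundary x = 0} \<and>
         (\<forall>n\<ge>1. boundary ` (A_sub n :: ('i, 'f) alg set) = {x \<in> A_sub (n + 1). boundary x = 0})"
proof (intro conjI allI impI set_eqI iffI)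
  fix x :: "('i, 'f) alg" assume "x \<in> range iota"
  then obtain a where x: "x = word_sum False 1 (\<lambda>ys. a * unit_cochain ys)"
    using iota_eq_word_sum by blast
  have f: "normalized 1 (\<lambda>ys :: 'i list. a * unit_cochain ys)"
    using normalized_unit_cochain by (auto simp: normalized_def)
  \<comment> \<open>The constant cochain in degree one is the coboundary of the indicator of the
    empty list, hence a cocycle.\<close>
  have unit: "unit_cochain = coboundary (\<lambda>ys :: 'i list. if ys = [] then 1 else 0 :: 'f)"
  proof
    fix ys :: "'i list"
    show "unit_cochain ys = coboundary (\<lambda>ys :: 'i list. if ys = [] then 1 else 0 :: 'f) ys"
      by (cases ys) (auto simp: unit_cochain_def)
  qed
  have "coboundary unit_cochain ys = (0 :: 'f)" for ys :: "'i list"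
    unfolding unit by (rule coboundary_coboundary)
  then have "coboundary (\<lambda>ys :: 'i list. a * unit_cochain ys) ys = 0" for ys
    by (simp add: coboundary_scale)
  then have "boundary x = 0"
    using f by (simp add: x boundary_word_sum_eq_0_iff)
  moreover have "x \<in> A_sub 1"
    using f by (auto simp: x A_sub_eq_word_sum)
  ultimately show "x \<in> {x \<in> A_sub 1. boundary x = 0}" by simp
next
  fix x :: "('i, 'f) alg" assume x: "x \<in> {x \<in> A_sub 1. boundary x = 0}"
  then obtain f where f: "normalized 1 f" "x = word_sum False 1 f"
    by (auto simp: A_sub_eq_word_sum)
  then have "\<And>ys. coboundary f ys = 0"
    using x by (simp add: boundary_word_sum_eq_0_iff)
  then obtain g where g: "normalized 0 g" "f = coboundary g"
    using coboundary_exact[of 0 f] f by auto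
  \<comment> \<open>A cochain of degree zero is the single value \<open>g []\<close>, and its
    coboundary takes this value on all one-entry lists; so the cocycles of degree one are the
    scalars.\<close>
  have "f ys = g [] * unit_cochain ys" for ys
  proof (cases "length ys = 1")
    case True
    then show ?thesis by (auto simp: g(2) unit_cochain_def length_Suc_conv)
  next
    case False
    then show ?thesis using f(1) by (auto simp: normalized_def unit_cochain_def)
  qed
  then have "f = (\<lambda>ys. g [] * unit_cochain ys)" by (rule ext)
  then show "x \<in> range iota" by (auto simp: f(2) iota_eq_word_sum)
next
  fix n :: nat and x :: "('i, 'f) alg" assume n: "1 \<le> n" and "x \<in> boundary ` A_sub n"
  then obtain f where f: "normalized n f" "x = word_sum False (Suc n) (coboundary f)"
    by (auto simp: A_sub_eq_word_sum boundary_word_sum)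
  then show "x \<in> {x \<in> A_sub (n + 1). boundary x = 0}"
    using normalized_coboundary[OF f(1)]
    by (simp add: A_sub_eq_word_sum boundary_word_sum_eq_0_iff coboundary_coboundary)
next
  fix n :: nat and x :: "('i, 'f) alg"
  assume n: "1 \<le> n" and x: "x \<in> {x \<in> A_sub (n + 1). boundary x = 0}"
  then obtain f where f: "normalized (Suc n) f" "x = word_sum False (Suc n) f"
    by (auto simp: A_sub_eq_word_sum)
  then have "\<And>ys. coboundary f ys = 0"
    using x by (simp add: boundary_word_sum_eq_0_iff)
  \<comment> \<open>The contraction yields a primitive of degree \<open>n\<close>; as
    \<open>n \<ge> 1\<close>, it represents an element of \<open>A_sub n\<close>.\<close>
  then obtain g where "normalized n g" "f = coboundary g"
    using coboundary_exact[OF f(1)] by blast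
  then show "x \<in> boundary ` A_sub n"
    using n f(2) by (auto simp: A_sub_eq_word_sum boundary_word_sum image_image intro!: image_eqI[of _ _ g])
qed

end
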